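(* Let $n=4k+r$ with integers $k\ge 0$ and $0\le r<4$. Then $$t_n=2^{k+\lfloor r/2\rfloor}\sum_{i=0}^{k}2^{i}\binom{k}{i}\frac{(1;2)_{k+\lfloor r/2\rfloor}}{(1;2)_{i+\lfloor r/2\rfloor}}\,g_{4i+r}.$$
   Context: $t_n$ is the number of involutions (permutations $\pi$ with $\pi^2=1$) of $[n]$, with $t_0=1$. $(a;b)_m=\prod_{j=0}^{m-1}(a+jb)$, so $(1;2)_m$ is the product of the first $m$ odd positive integers. For $m=2u+\rho$ with $\rho\in\{0,1\}$, let $V_m=\{v_1,\dots,v_u\}$ if $\rho=0$ and $V_m=\{v_1,\dots,v_{u+1}\}$ if $\rho=1$; $\mathfrak{G}_m$ is the set of loopless multigraphs on $V_m$ in which each vertex has degree at most $2$, $v_{u+1}$ (if present) has degree at most $1$, and each edge has multiplicity at most $2$. $g_m$ is the number of graphs in $\mathfrak{G}_m$ having no edge of multiplicity $2$. *)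

theory Defs
  imports Complex_Main "HOL-Library.Multiset" "HOL-Combinatorics.Permutations"
begin

text \<open>The number \<open>t\<^sub>n\<close> of permutations \<open>p\<close> of \<open>{1..n}\<close> with \<open>p\<^sup>2 = 1\<close>; the identity counts.\<close>

definition num_involutions :: "nat \<Rightarrow> nat" where
  "num_involutions n = card {p. p permutes {1..n} \<and> p \<circ> p = id}"

text \<open>The product \<open>(a;b)\<^sub>m = a (a + b) \<dots> (a + (m - 1) b)\<close>.\<close>

definition step_prod :: "'a::comm_semiring_1 \<Rightarrow> 'a \<Rightarrow> nat \<Rightarrow> 'a" where
  "step_prod a b m = (\<Prod>j<m. a + of_nat j * b)"

text \<open>The vertex \<open>v\<^sub>j\<close> is the number \<open>j\<close>. With \<open>m = 2 u + \<rho>\<close>, \<open>\<rho> < 2\<close>, we have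
  \<open>u = m div 2\<close> and \<open>\<rho> = m mod 2\<close>.\<close>

definition verts :: "nat \<Rightarrow> nat set" where
  "verts m = {1..m div 2 + m mod 2}"

text \<open>A loopless multigraph on a fixed labelled vertex set is given by its multiset of edges, an edge
  being a two-element set of vertices. The multiplicity of an edge is its \<^const>\<open>count\<close>, and
  degrees are counted with multiplicity.\<close>

definition loopless_multigraph :: "'v set \<Rightarrow> 'v set multiset \<Rightarrow> bool" where
  "loopless_multigraph V E \<longleftrightarrow> (\<forall>e \<in># E. e \<subseteq> V \<and> card e = 2)"

definition degree :: "'v set multiset \<Rightarrow> 'v \<Rightarrow> nat" where
  "degree E v = size {#e \<in># E. v \<in> e#}"

definition multigraphs :: "nat \<Rightarrow> nat set multiset set" where
  "multigraphs m = {E. loopless_multigraph (verts m) E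
      \<and> (\<forall>v \<in> verts m. degree E v \<le> 2)
      \<and> (odd m \<longrightarrow> degree E (m div 2 + 1) \<le> 1)
      \<and> (\<forall>e. count E e \<le> 2)}"

definition num_graphs :: "nat \<Rightarrow> nat" where
  "num_graphs m = card {E \<in> multigraphs m. \<nexists>e. count E e = 2}"

end

theory Submission
  imports Defs
begin

text \<open>
  Merging the points of an involution in pairs turns its transpositions into the edges of a
  multigraph with degrees at most 2 (loops are discarded), and each multigraph with \<open>u\<close> merged pairs and \<open>d\<close> double edges
  arises from \<open>2\<^sup>u\<^sup>-\<^sup>d\<close> involutions. Removing the double edges, which form a matching, expresses \<open>t\<^sub>n\<close>
  as a sum over \<open>d\<close> of \<open>2\<^sup>u\<^sup>-\<^sup>d\<close> times the number of \<open>d\<close>-edge matchings times a number of simple graphs.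

  Instead of a bijection, recurrences are compared. Let \<open>G(a, b)\<close> be the number of simple graphs on
  \<open>a\<close> vertices of capacity 2 and \<open>b\<close> vertices of capacity 1. Removing one vertex and lowering the
  capacities of its neighbours gives a recurrence for \<open>G\<close>, and hence one for
  \<open>W(a, b) = \<Sum>\<^sub>d M(a, d) 2\<^sup>-\<^sup>d G(a - 2d, b)\<close>, where \<open>M(a, d)\<close> counts the matchings with \<open>d\<close> edges;
  \<open>2\<^sup>a W(a, b)\<close> then satisfies the recurrence of \<open>t\<close> at \<open>2a + b\<close>.
\<close>

section \<open>Involutions\<close>

fun invol :: "nat \<Rightarrow> nat" where
  "invol 0 = 1"
| "invol (Suc 0) = 1"
| "invol (Suc (Suc n)) = invol (Suc n) + Suc n * invol n"

text \<open>An arbitrary carrier replaces \<open>{1..n}\<close> so that points can be deleted in an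
  induction.\<close>

definition involutions :: "'a set \<Rightarrow> ('a \<Rightarrow> 'a) set" where
  "involutions S = {p. p permutes S \<and> p \<circ> p = id}"

lemma involutions_iff:
  "p \<in> involutions S \<longleftrightarrow> (\<forall>v. p (p v) = v) \<and> (\<forall>v. v \<notin> S \<longrightarrow> p v = v)"
proof -
  have "p permutes S" if "\<And>v. p (p v) = v" "\<And>v. v \<notin> S \<Longrightarrow> p v = v"
    unfolding permutes_def using that by metis
  then show ?thesis by (auto simp: involutions_def fun_eq_iff dest: permutes_not_in)
qed

lemma finite_involutions: "finite S \<Longrightarrow> finite (involutions S)"
  unfolding involutions_def by (rule finite_subset[OF _ finite_permutations]) auto

lemma involutions_fixing: "{p \<in> involutions S. p x = x} = involutions (S - {x})"
  by (auto simp: involutions_iff)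

text \<open>Composing with the transposition of \<open>x\<close> and \<open>y\<close> removes a
  2-cycle or restores it, so the same map serves as its own inverse.\<close>

lemma card_involutions_swapping:
  assumes "x \<in> S" "y \<in> S" "x \<noteq> y"
  shows "card {p \<in> involutions S. p x = y} = card (involutions (S - {x, y}))"
proof (rule bij_betw_same_card)
  let ?f = "\<lambda>p. transpose x y \<circ> p"
  have inv: "?f (?f p) = p" for p by (auto simp: fun_eq_iff)
  show "bij_betw ?f {p \<in> involutions S. p x = y} (involutions (S - {x, y}))"
  proof (rule bij_betw_byWitness[where f' = ?f])
    show "?f ` {p \<in> involutions S. p x = y} \<subseteq> involutions (S - {x, y})"
    proof safe
      fix p assume p: "p \<in> involutions S" and y: "y = p x"
      have pp: "p (p v) = v" for v using p by (simp add: involutions_iff)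
      have "(transpose x (p x) \<circ> p) ((transpose x (p x) \<circ> p) v) = v" for v
      proof -
        \<comment> \<open>These equivalences say that \<open>p\<close> exchanges \<open>x\<close>
          and \<open>p x\<close> and sends no other point to either of them, so \<open>p\<close>
          commutes with the transposition.\<close>
        have "p v = x \<longleftrightarrow> v = p x" "p v = p x \<longleftrightarrow> v = x" using pp by metis+
        then show ?thesis using pp by (auto simp: transpose_def)
      qed
      moreover have "(transpose x (p x) \<circ> p) v = v" if "v \<notin> S - {x, p x}" for v
        using that p assms y by (auto simp: involutions_iff transpose_def)
      ultimately show "transpose x (p x) \<circ> p \<in> involutions (S - {x, p x})"
        unfolding involutions_iff by blast
    qed
    show "?f ` involutions (S - {x, y}) \<subseteq> {p \<in> involutions S. p x = y}"
    proof safe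
      fix p assume p: "p \<in> involutions (S - {x, y})"
      have pp: "p (p v) = v" for v using p by (simp add: involutions_iff)
      have fx: "p x = x" "p y = y" using p by (auto simp: involutions_iff)
      have "?f p (?f p v) = v" for v
        using pp[of v] fx by (auto simp: transpose_def)
      moreover have "?f p v = v" if "v \<notin> S" for v
        using that p assms by (auto simp: involutions_iff transpose_def)
      ultimately show "?f p \<in> involutions S" 
        unfolding involutions_iff by blast
      show "?f p x = y" using fx by simp
    qed
  qed (use inv in auto)
qed

text \<open>Involutions are classified by the image of a chosen point \<open>x\<close>: either
  \<open>x\<close> is fixed and one point disappears, or \<open>x\<close> is swapped with one of the
  other points and two disappear.\<close>

lemma card_involutions:
  assumes "finite S" "card S = n"
  shows "card (involutions S) = invol n"
  using assms
proof (induction n arbitrary: S rule: invol.induct)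
  case 1
  then have "involutions S = {id}" by (auto simp: involutions_def)
  then show ?case by simp
next
  case 2
  then obtain x where "S = {x}" by (auto simp: card_Suc_eq)
  then have "involutions S = {id}" by (auto simp: involutions_def)
  then show ?case by simp
next
  case (3 n)
  note S = 3(3,4)
  then obtain x where x: "x \<in> S" by fastforce
  have part: "involutions S = (\<Union>y\<in>S. {p \<in> involutions S. p x = y})"
    using x by (auto simp: involutions_def permutes_in_image)
  have "card (involutions S) = (\<Sum>y\<in>S. card {p \<in> involutions S. p x = y})"
    by (subst part, subst card_UN_disjoint) (use S finite_involutions[of S] in auto)
  also have "\<dots> = card {p \<in> involutions S. p x = x} + (\<Sum>y\<in>S-{x}. card {p \<in> involutions S. p x = y})"
    using x S by (simp add: sum.remove)
  also have "(\<Sum>y\<in>S-{x}. card {p \<in> involutions S. p x = y}) = (\<Sum>y\<in>S-{x}. invol n)"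
  proof (rule sum.cong)
    fix y assume y: "y \<in> S - {x}"
    then have "card (S - {x, y}) = n"
      using x S by (auto simp: card_Diff_subset)
    then show "card {p \<in> involutions S. p x = y} = invol n"
      using card_involutions_swapping[of x S y] x y 3(2)[of "S - {x, y}"] S by auto
  qed simp
  also have "card {p \<in> involutions S. p x = x} = invol (Suc n)"
    using 3(1)[of "S - {x}"] S x by (simp add: involutions_fixing)
  finally show ?case using x S by simp
qed

lemma num_involutions_eq: "num_involutions n = invol n"
  using card_involutions[of "{1..n}" n] by (simp add: num_involutions_def involutions_def)

section \<open>Simple graphs with vertex capacities\<close>

text \<open>Capacities vary from vertex to vertex, so the class is closed under deleting a vertex
  and charging its edges to the neighbours.\<close>

definition capped_graphs :: "'v set \<Rightarrow> ('v \<Rightarrow> nat) \<Rightarrow> 'v set set set" where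
  "capped_graphs V c = {E. (\<forall>e\<in>E. e \<subseteq> V \<and> card e = 2) \<and> (\<forall>v\<in>V. card {e \<in> E. v \<in> e} \<le> c v)}"

text \<open>Vertices of capacity 0 are excluded, which keeps the truncated subtraction in
  \<open>lower_cap\<close> exact.\<close>

definition neighbourhoods :: "'v set \<Rightarrow> ('v \<Rightarrow> nat) \<Rightarrow> 'v \<Rightarrow> 'v set set" where
  "neighbourhoods V c x = {N. N \<subseteq> {y \<in> V - {x}. c y > 0} \<and> card N \<le> c x}"

abbreviation lower_cap :: "('v \<Rightarrow> nat) \<Rightarrow> 'v set \<Rightarrow> 'v \<Rightarrow> nat" where
  "lower_cap c N \<equiv> \<lambda>v. if v \<in> N then c v - 1 else c v"

lemma finite_capped_graphs: "finite V \<Longrightarrow> finite (capped_graphs V c)"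
  unfolding capped_graphs_def by (rule finite_subset[of _ "Pow (Pow V)"]) auto

text \<open>A graph is determined by the neighbourhood \<open>N\<close> of \<open>x\<close> and the
  graph left after deleting \<open>x\<close>. Each member of \<open>N\<close> has spent one unit of
  capacity on its edge to \<open>x\<close>, and no other vertex is affected.\<close>

lemma card_capped_graphs_remove:
  assumes V: "finite V" and x: "x \<in> V"
  shows "card (capped_graphs V c)
    = (\<Sum>N\<in>neighbourhoods V c x. card (capped_graphs (V - {x}) (lower_cap c N)))"
proof -
  let ?S = "Sigma (neighbourhoods V c x) (\<lambda>N. capped_graphs (V - {x}) (lower_cap c N))"
  let ?f = "\<lambda>E. ({y. {x, y} \<in> E}, {e \<in> E. x \<notin> e})"
  let ?g = "\<lambda>(N, E). E \<union> (\<lambda>y. {x, y}) ` N"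
  have edge: "\<exists>y\<in>V - {x}. e = {x, y}" if "E \<in> capped_graphs V c" "e \<in> E" "x \<in> e" for E e
  proof -
    have "card e = 2" "e \<subseteq> V" using that by (auto simp: capped_graphs_def)
    then show ?thesis using \<open>x \<in> e\<close> by (auto simp: card_2_iff)
  qed
  have loop: "{x, y} \<in> E \<Longrightarrow> y \<in> V - {x}" if "E \<in> capped_graphs V c" for E y
    using that by (fastforce simp: capped_graphs_def)
  have finE: "finite E" if "E \<in> capped_graphs V c" for E
    using that V by (intro finite_subset[of E "Pow V"]) (auto simp: capped_graphs_def)
  have finE': "finite E" if "E \<in> capped_graphs (V - {x}) c'" for E c'
    using that V by (intro finite_subset[of E "Pow V"]) (auto simp: capped_graphs_def)
  have inj: "inj_on (\<lambda>y. {x, y}) N" if "x \<notin> N" for N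
    using that by (auto simp: inj_on_def doubleton_eq_iff)
  have "bij_betw ?f (capped_graphs V c) ?S"
  proof (rule bij_betw_byWitness[where f' = ?g])
    show "\<forall>E\<in>capped_graphs V c. ?g (?f E) = E"
    proof (rule ballI)
      fix E assume E: "E \<in> capped_graphs V c"
      have "e \<in> ?g (?f E)" if "e \<in> E" for e
        using edge[OF E that] that by (cases "x \<in> e") auto
      then show "?g (?f E) = E" by auto
    qed
    show "\<forall>z\<in>?S. ?f (?g z) = z"
    proof (rule ballI)
      fix z assume "z \<in> ?S"
      then obtain N E where z: "z = (N, E)" and N: "N \<in> neighbourhoods V c x"
        and E: "E \<in> capped_graphs (V - {x}) (lower_cap c N)"
        by blast
      have xE: "x \<notin> e" if "e \<in> E" for e using E that by (auto simp: capped_graphs_def)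
      have "x \<notin> N" using N by (auto simp: neighbourhoods_def)
      then have "{y. {x, y} \<in> ?g (N, E)} = N"
        using xE by (auto simp: doubleton_eq_iff)
      moreover have "{e \<in> ?g (N, E). x \<notin> e} = E" using xE by auto
      ultimately show "?f (?g z) = z" unfolding z by blast
    qed
    show "?f ` capped_graphs V c \<subseteq> ?S"
    proof safe
      fix E assume E: "E \<in> capped_graphs V c"
      let ?N = "{y. {x, y} \<in> E}"
      have deg: "card {e \<in> E. v \<in> e} \<le> c v" if "v \<in> V" for v
        using E that by (auto simp: capped_graphs_def)
      have "{e \<in> E. x \<in> e} = (\<lambda>y. {x, y}) ` ?N"
        using edge[OF E] by (auto simp: image_iff)
      moreover have "x \<notin> ?N" using loop[OF E] by blast
      ultimately have "card ?N \<le> c x"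
        using deg[OF x] card_image[OF inj] by metis
      moreover have "c y > 0" if "{x, y} \<in> E" for y
      proof -
        have "card {e \<in> E. y \<in> e} > 0"
          using that finE[OF E] by (auto simp: card_gt_0_iff)
        then show ?thesis using deg[of y] loop[OF E that] by auto
      qed
      ultimately show "?N \<in> neighbourhoods V c x"
        using loop[OF E] by (auto simp: neighbourhoods_def)
      have "card {e \<in> {e \<in> E. x \<notin> e}. v \<in> e} \<le> lower_cap c ?N v" if v: "v \<in> V - {x}" for v
      proof (cases "{x, v} \<in> E")
        case True
        have "{e \<in> {e \<in> E. x \<notin> e}. v \<in> e} \<subseteq> {e \<in> E. v \<in> e} - {{x, v}}" by auto
        then have "card {e \<in> {e \<in> E. x \<notin> e}. v \<in> e} \<le> card ({e \<in> E. v \<in> e} - {{x, v}})"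
          by (intro card_mono) (use finE[OF E] in auto)
        also have "\<dots> = card {e \<in> E. v \<in> e} - 1"
          using True finE[OF E] by (subst card_Diff_singleton) auto
        finally show ?thesis using deg[of v] v True by auto
      next
        case False
        have "card {e \<in> {e \<in> E. x \<notin> e}. v \<in> e} \<le> card {e \<in> E. v \<in> e}"
          by (intro card_mono) (use finE[OF E] in auto)
        then show ?thesis using deg[of v] v False by auto
      qed
      then show "{e \<in> E. x \<notin> e} \<in> capped_graphs (V - {x}) (lower_cap c ?N)"
        using E by (auto simp: capped_graphs_def)
    qed
    show "?g ` ?S \<subseteq> capped_graphs V c"
    proof safe
      fix N E
      assume N: "N \<in> neighbourhoods V c x"
        and E: "E \<in> capped_graphs (V - {x}) (lower_cap c N)"
      let ?E = "E \<union> (\<lambda>y. {x, y}) ` N"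
      have xN: "x \<notin> N" and NV: "N \<subseteq> V" and Ncap: "card N \<le> c x" "\<And>y. y \<in> N \<Longrightarrow> c y > 0"
        using N by (auto simp: neighbourhoods_def)
      have xE: "x \<notin> e" if "e \<in> E" for e using E that by (auto simp: capped_graphs_def)
      have "card {e \<in> ?E. v \<in> e} \<le> c v" if v: "v \<in> V" for v
      proof (cases "v = x")
        case True
        have "{e \<in> ?E. x \<in> e} = (\<lambda>y. {x, y}) ` N" using xE by auto
        then show ?thesis using True card_image[OF inj[OF xN]] Ncap by simp
      next
        case False
        have deg: "card {e \<in> E. v \<in> e} \<le> lower_cap c N v"
          using E v False by (auto simp: capped_graphs_def)
        have "{e \<in> ?E. v \<in> e} = {e \<in> E. v \<in> e} \<union> (if v \<in> N then {{x, v}} else {})"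
          using False by auto
        then have "card {e \<in> ?E. v \<in> e} \<le> card {e \<in> E. v \<in> e} + (if v \<in> N then 1 else 0)"
          by (auto intro: order_trans[OF card_insert_le_m1] simp: card_insert_if finE'[OF E])
        then show ?thesis using deg Ncap(2)[of v] by (auto split: if_splits)
      qed
      moreover have "e \<subseteq> V \<and> card e = 2" if "e \<in> ?E" for e
        using that E xN NV x by (auto simp: capped_graphs_def card_2_iff)
      ultimately show "?E \<in> capped_graphs V c" by (auto simp: capped_graphs_def)
    qed
  qed
  then have "card (capped_graphs V c) = card ?S" by (rule bij_betw_same_card)
  also have "\<dots> = (\<Sum>N\<in>neighbourhoods V c x. card (capped_graphs (V - {x}) (lower_cap c N)))"
    by (rule card_SigmaI)
       (use V finite_capped_graphs in \<open>auto simp: neighbourhoods_def\<close>)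
  finally show ?thesis .
qed

section \<open>Recurrence for graphs with capacities at most 2\<close>

text \<open>The arguments are the numbers of vertices of capacity 2 and of capacity 1. A vertex of
  capacity 1 is deleted if there is one: it is isolated, or its neighbour drops from 1 to 0, or from
  2 to 1. Otherwise a vertex of capacity 2 is deleted; the cases of at most one neighbour together
  give \<open>graph_count a 1\<close>, and two neighbours give the binomial term.\<close>

fun graph_count :: "nat \<Rightarrow> nat \<Rightarrow> nat" where
  "graph_count 0 0 = 1"
| "graph_count 0 (Suc b) = graph_count 0 b + b * graph_count 0 (b - 1)"
| "graph_count (Suc a) (Suc b) =
    graph_count (Suc a) b + b * graph_count (Suc a) (b - 1) + Suc a * graph_count a (Suc b)"
| "graph_count (Suc a) 0 =
    graph_count a 1 + (if a < 2 then 0 else (a choose 2) * graph_count (a - 2) 2)"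

lemma graph_count_Suc_right:
  "graph_count a (Suc b) =
    graph_count a b + b * graph_count a (b - 1) + a * graph_count (a - 1) (Suc b)"
  by (cases a) auto

text \<open>The binomial coefficient vanishes for \<open>a < 2\<close>, which absorbs the case
  distinction of the recursion.\<close>

lemma graph_count_Suc_0:
  "graph_count (Suc a) 0 = graph_count a 1 + (a choose 2) * graph_count (a - 2) 2"
  by auto

declare graph_count.simps [simp del]

lemma subsets_card_le_1:
  assumes "finite S"
  shows "{N. N \<subseteq> S \<and> card N \<le> 1} = insert {} ((\<lambda>y. {y}) ` S)"
proof -
  have "N \<in> insert {} ((\<lambda>y. {y}) ` S)" if "N \<subseteq> S" "card N \<le> 1" for N
  proof -
    have "card N = 0 \<or> card N = 1" using that by linarith
    moreover have "finite N" using that assms finite_subset by blast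
    ultimately have "N = {} \<or> (\<exists>y. N = {y})" by (metis card_0_eq card_1_singletonE)
    then show ?thesis using that by auto
  qed
  then show ?thesis by auto
qed

lemma sum_subsets_card_le_1:
  "finite S \<Longrightarrow> (\<Sum>N | N \<subseteq> S \<and> card N \<le> 1. f N) = f {} + (\<Sum>y\<in>S. f {y})"
  unfolding subsets_card_le_1 by (subst sum.insert) (auto simp: sum.reindex)

text \<open>Induction on the number of vertices, deleting one vertex at a time. Vertices of capacity
  0 are isolated and contribute to neither argument.\<close>

lemma card_capped_graphs:
  assumes "finite V" "\<And>v. v \<in> V \<Longrightarrow> c v \<le> 2"
  shows "card (capped_graphs V c) = graph_count (card {v \<in> V. c v = 2}) (card {v \<in> V. c v = 1})"
  using assms
proof (induction "card V" arbitrary: V c rule: less_induct)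
  case less
  note V = less.prems(1) and c = less.prems(2)
  show ?case
  proof (cases "V = {}")
    case True
    then have "capped_graphs V c = {{}}" by (auto simp: capped_graphs_def)
    then show ?thesis using True by (simp add: graph_count.simps)
  next
    case False
    \<comment> \<open>The order of preference 1, 2, 0 for the capacity of the deleted vertex follows
      the recursion of \<open>graph_count\<close>.\<close>
    have "\<exists>x\<in>V. c x = 1 \<or> c x = 2 \<and> (\<forall>v\<in>V. c v \<noteq> 1) \<or> (\<forall>v\<in>V. c v = 0)"
    proof -
      have "c v = 0 \<or> c v = 1 \<or> c v = 2" if "v \<in> V" for v using c[OF that] by auto
      then show ?thesis using False by blast
    qed
    then obtain x where x: "x \<in> V"
      and x_cases: "c x = 1 \<or> c x = 2 \<and> (\<forall>v\<in>V. c v \<noteq> 1) \<or> (\<forall>v\<in>V. c v = 0)"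
      by blast
    define A where "A = {v \<in> V - {x}. c v = 2}"
    define B where "B = {v \<in> V - {x}. c v = 1}"
    have fin: "finite A" "finite B" using V by (auto simp: A_def B_def)
    have disj: "A \<inter> B = {}" by (auto simp: A_def B_def)
    have pos: "{y \<in> V - {x}. c y > 0} = A \<union> B"
      using c unfolding A_def B_def by force
    \<comment> \<open>Neighbours in \<open>A\<close> move to capacity 1, and neighbours in
      \<open>B\<close> drop to capacity 0 and leave the count.\<close>
    have remove: "card (capped_graphs (V - {x}) (lower_cap c N))
        = graph_count (card (A - N)) (card (B - N) + card (A \<inter> N))" if N: "N \<subseteq> A \<union> B" for N
    proof -
      have "{v \<in> V - {x}. lower_cap c N v = 2} = A - N"
        using N c by (force simp: A_def B_def)
      moreover have "{v \<in> V - {x}. lower_cap c N v = 1} = (B - N) \<union> (A \<inter> N)"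
        using N by (auto simp: A_def B_def)
      moreover have "card ((B - N) \<union> (A \<inter> N)) = card (B - N) + card (A \<inter> N)"
        by (rule card_Un_disjoint) (use fin disj in auto)
      moreover have "lower_cap c N v \<le> 2" if "v \<in> V - {x}" for v
        using c[of v] that by auto
      moreover have "card (V - {x}) < card V" using V x by (rule card_Diff1_less)
      ultimately show ?thesis using less.hyps[of "V - {x}" "lower_cap c N"] V by simp
    qed
    have recurrence: "card (capped_graphs V c) = (\<Sum>N | N \<subseteq> A \<union> B \<and> card N \<le> c x.
        graph_count (card (A - N)) (card (B - N) + card (A \<inter> N)))"
      unfolding card_capped_graphs_remove[OF V x] neighbourhoods_def pos
      by (rule sum.cong) (simp_all add: remove)
    consider (zero) "\<forall>v\<in>V. c v = 0" | (one) "c x = 1" | (two) "c x = 2" "\<forall>v\<in>V. c v \<noteq> 1"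
      using x_cases by blast
    then show ?thesis
    proof cases
      case zero
      then have AB: "A = {}" "B = {}" by (auto simp: A_def B_def)
      then have "{N. N \<subseteq> A \<union> B \<and> card N \<le> c x} = {{}}" by auto
      moreover have "{v \<in> V. c v = 2} = {}" "{v \<in> V. c v = 1} = {}" using zero by auto
      ultimately show ?thesis unfolding recurrence by (simp only: AB) simp
    next
      case one
      have AB: "{v \<in> V. c v = 2} = A" "{v \<in> V. c v = 1} = insert x B" "x \<notin> B"
        using x one by (auto simp: A_def B_def)
      have "card (capped_graphs V c) = graph_count (card A) (card B)
          + (\<Sum>y\<in>A \<union> B. graph_count (card (A - {y})) (card (B - {y}) + card (A \<inter> {y})))"
        unfolding recurrence one by (subst sum_subsets_card_le_1) (use fin in simp_all)
      also have "(\<Sum>y\<in>A \<union> B. graph_count (card (A - {y})) (card (B - {y}) + card (A \<inter> {y})))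
          = (\<Sum>y\<in>A. graph_count (card A - 1) (Suc (card B))) + (\<Sum>y\<in>B. graph_count (card A) (card B - 1))"
      proof (subst sum.union_disjoint[OF fin disj], rule arg_cong2[of _ _ _ _ "(+)"]; rule sum.cong)
        fix y assume y: "y \<in> A"
        then have "B - {y} = B" "A \<inter> {y} = {y}" using disj by auto
        then show "graph_count (card (A - {y})) (card (B - {y}) + card (A \<inter> {y}))
          = graph_count (card A - 1) (Suc (card B))" using fin y by simp
      next
        fix y assume y: "y \<in> B"
        then have "A - {y} = A" "A \<inter> {y} = {}" using disj by auto
        then show "graph_count (card (A - {y})) (card (B - {y}) + card (A \<inter> {y}))
          = graph_count (card A) (card B - 1)" using fin y by simp
      qed simp_all
      finally show ?thesis
        using AB fin graph_count_Suc_right[of "card A" "card B"] by simp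
    next
      case two
      have AB: "{v \<in> V. c v = 2} = insert x A" "{v \<in> V. c v = 1} = {}" "x \<notin> A" "B = {}"
        using x two by (auto simp: A_def B_def)
      \<comment> \<open>Neighbourhoods of size at most 1 contribute the same as if \<open>x\<close>
        had capacity 1, hence \<open>graph_count (card A) 1\<close>; those of size 2 are counted by
        a binomial coefficient.\<close>
      have split: "{N. N \<subseteq> A \<union> B \<and> card N \<le> c x}
          = {N. N \<subseteq> A \<and> card N \<le> 1} \<union> {N. N \<subseteq> A \<and> card N = 2}"
        using AB two by auto
      have "card (capped_graphs V c)
          = (\<Sum>N | N \<subseteq> A \<and> card N \<le> 1. graph_count (card (A - N)) (card (A \<inter> N)))
          + (\<Sum>N | N \<subseteq> A \<and> card N = 2. graph_count (card (A - N)) (card (A \<inter> N)))"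
        unfolding recurrence split using fin AB by (subst sum.union_disjoint) auto
      also have "(\<Sum>N | N \<subseteq> A \<and> card N \<le> 1. graph_count (card (A - N)) (card (A \<inter> N)))
          = graph_count (card A) 0 + (\<Sum>y\<in>A. graph_count (card (A - {y})) (card (A \<inter> {y})))"
        using fin by (subst sum_subsets_card_le_1) simp_all
      also have "(\<Sum>y\<in>A. graph_count (card (A - {y})) (card (A \<inter> {y})))
          = (\<Sum>y\<in>A. graph_count (card A - 1) 1)"
        by (rule sum.cong) (use fin in auto)
      also have "(\<Sum>N | N \<subseteq> A \<and> card N = 2. graph_count (card (A - N)) (card (A \<inter> N)))
          = (\<Sum>N | N \<subseteq> A \<and> card N = 2. graph_count (card A - 2) 2)"
      proof (rule sum.cong)
        fix N assume "N \<in> {N. N \<subseteq> A \<and> card N = 2}"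
        then have N: "N \<subseteq> A" "card N = 2" by auto
        then have "card (A - N) = card A - 2"
          using card_Diff_subset[of N A] finite_subset[OF N(1) fin(1)] by simp
        moreover have "A \<inter> N = N" using N by blast
        ultimately show "graph_count (card (A - N)) (card (A \<inter> N)) = graph_count (card A - 2) 2"
          using N by simp
      qed simp
      finally show ?thesis
        unfolding AB(1,2) using AB fin graph_count_Suc_right[of "card A" 0]
        by (simp add: n_subsets graph_count_Suc_0)
    qed
  qed
qed

section \<open>From multigraphs without double edges to capped graphs\<close>

lemma degree_mset_set: "finite E \<Longrightarrow> degree (mset_set E) v = card {e \<in> E. v \<in> e}"
  by (simp add: degree_def)

text \<open>Without double edges all multiplicities are at most 1, so the multiset of edges is a
  set. The degree bounds become capacity 2 everywhere, except capacity 1 at the extra vertex for odd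
  \<open>m\<close>.\<close>

lemma num_graphs_eq: "num_graphs m = graph_count (m div 2) (m mod 2)"
proof -
  define c where "c v = (if odd m \<and> v = m div 2 + 1 then 1 else 2 :: nat)" for v
  have fin: "finite E" if "\<forall>e\<in>E. e \<subseteq> verts m \<and> card e = 2" for E
    using that by (intro finite_subset[of E "Pow (verts m)"]) (auto simp: verts_def)
  have top: "m div 2 + 1 \<in> verts m" if "odd m"
    using that by (auto simp: verts_def odd_iff_mod_2_eq_one)
  have mset: "mset_set (set_mset E) = E" if E: "E \<in> multigraphs m" "\<nexists>e. count E e = 2" for E
  proof (rule multiset_eqI)
    fix e
    have "count E e \<le> 2" "count E e \<noteq> 2" using E by (auto simp: multigraphs_def)
    then have "count E e \<le> 1" by simp
    then have "count E e = (if e \<in># E then 1 else 0)"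
      using count_greater_zero_iff[of E e] by (simp del: count_greater_zero_iff) linarith
    then show "count (mset_set (set_mset E)) e = count E e" by simp
  qed
  have deg: "(\<forall>v\<in>verts m. d v \<le> c v)
      \<longleftrightarrow> (\<forall>v\<in>verts m. d v \<le> 2) \<and> (odd m \<longrightarrow> d (m div 2 + 1) \<le> 1)" for d
  proof (intro iffI conjI ballI impI)
    fix v assume "\<forall>v\<in>verts m. d v \<le> c v" "v \<in> verts m"
    then have "d v \<le> c v" by blast
    then show "d v \<le> 2" by (simp add: c_def split: if_splits)
  next
    assume "\<forall>v\<in>verts m. d v \<le> c v" "odd m"
    then show "d (m div 2 + 1) \<le> 1" using top by (fastforce simp: c_def)
  qed (auto simp: c_def)
  have "bij_betw mset_set (capped_graphs (verts m) c) {E \<in> multigraphs m. \<nexists>e. count E e = 2}"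
  proof (rule bij_betw_byWitness[where f' = set_mset])
    show "\<forall>E\<in>capped_graphs (verts m) c. set_mset (mset_set E) = E"
      using fin by (auto simp: capped_graphs_def)
    show "\<forall>E\<in>{E \<in> multigraphs m. \<nexists>e. count E e = 2}. mset_set (set_mset E) = E"
      using mset by blast
    show "mset_set ` capped_graphs (verts m) c \<subseteq> {E \<in> multigraphs m. \<nexists>e. count E e = 2}"
    proof (rule image_subsetI)
      fix E assume E: "E \<in> capped_graphs (verts m) c"
      then have "finite E" using fin by (auto simp: capped_graphs_def)
      then show "mset_set E \<in> {E \<in> multigraphs m. \<nexists>e. count E e = 2}"
        using E by (auto simp: capped_graphs_def deg multigraphs_def loopless_multigraph_def
            degree_mset_set count_mset_set')
    qed
    show "set_mset ` {E \<in> multigraphs m. \<nexists>e. count E e = 2} \<subseteq> capped_graphs (verts m) c"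
    proof (rule image_subsetI, clarify)
      fix E assume E: "E \<in> multigraphs m" "\<nexists>e. count E e = 2"
      have "degree E v = card {e \<in> set_mset E. v \<in> e}" for v
        using degree_mset_set[of "set_mset E" v] mset[OF E] by simp
      then show "set_mset E \<in> capped_graphs (verts m) c"
        using E(1) by (simp add: capped_graphs_def deg multigraphs_def loopless_multigraph_def)
    qed
  qed
  then have "num_graphs m = card (capped_graphs (verts m) c)"
    unfolding num_graphs_def by (simp add: bij_betw_same_card)
  also have "\<dots> = graph_count (card {v \<in> verts m. c v = 2}) (card {v \<in> verts m. c v = 1})"
    by (rule card_capped_graphs) (auto simp: verts_def c_def)
  also have "{v \<in> verts m. c v = 2} = {1..m div 2}"
    by (auto simp: verts_def c_def odd_iff_mod_2_eq_one split: if_splits)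
  also have "{v \<in> verts m. c v = 1} = (if odd m then {m div 2 + 1} else {})"
    using top by (auto simp: c_def)
  finally show ?thesis by (simp add: odd_iff_mod_2_eq_one)
qed

section \<open>Weighted sums over partial matchings\<close>

text \<open>The number of \<open>d\<close>-edge matchings of the complete graph on \<open>a\<close> vertices.\<close>

definition matching_count :: "nat \<Rightarrow> nat \<Rightarrow> nat" where
  "matching_count a d = (a choose (2 * d)) * step_prod 1 2 d"

lemma matching_count_0 [simp]: "matching_count a 0 = 1"
  by (simp add: matching_count_def step_prod_def)

lemma matching_count_eq_0: "a < 2 * d \<Longrightarrow> matching_count a d = 0"
  by (simp add: matching_count_def)

text \<open>Both sides count \<open>d\<close>-edge matchings on \<open>Suc a\<close> vertices with a
  marked uncovered vertex; on the right the mark is chosen first.\<close>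

lemma matching_count_absorb:
  "(Suc a - 2 * d) * matching_count (Suc a) d = Suc a * matching_count a d"
  using binomial_absorb_comp[of "Suc a" "2 * d"]
  by (simp only: matching_count_def mult.assoc[symmetric] diff_Suc_1)

text \<open>Combinatorially, a fixed vertex is either uncovered or matched to one of the
  \<open>Suc a\<close> others. The proof uses Pascal's rule instead.\<close>

lemma matching_count_Suc:
  "matching_count (Suc (Suc a)) (Suc d) = matching_count (Suc a) (Suc d) + Suc a * matching_count a d"
proof -
  have "Suc (2 * d) * (Suc a choose Suc (2 * d)) = Suc a * (a choose (2 * d))"
    using Suc_times_binomial[of "2 * d" a] by simp
  moreover have "step_prod 1 2 (Suc d) = Suc (2 * d) * step_prod 1 2 d"
    by (simp add: step_prod_def)
  ultimately have "(Suc a choose Suc (2 * d)) * step_prod 1 2 (Suc d) = Suc a * matching_count a d"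
    unfolding matching_count_def by (metis mult.assoc mult.commute)
  moreover have "Suc (Suc a) choose (2 * Suc d)
      = (Suc a choose Suc (2 * d)) + (Suc a choose (2 * Suc d))"
    by simp
  ultimately show ?thesis
    unfolding matching_count_def[of "Suc (Suc a)"] matching_count_def[of "Suc a"]
    by (simp only: distrib_right)
qed

text \<open>With \<open>f i = graph_count i b\<close> this is the sum \<open>W(a, b)\<close>.
  Keeping \<open>f\<close> abstract lets recurrences of \<open>graph_count\<close> be transferred by
  linearity. Terms with \<open>2 * d > a\<close>, where the subtraction truncates, have weight
  0.\<close>

definition matching_sum :: "nat \<Rightarrow> (nat \<Rightarrow> nat) \<Rightarrow> rat" where
  "matching_sum a f = (\<Sum>d\<le>a. of_nat (matching_count a d) / 2 ^ d * of_nat (f (a - 2 * d)))"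

lemma matching_sum_eq:
  assumes "a \<le> D"
  shows "matching_sum a f = (\<Sum>d\<le>D. of_nat (matching_count a d) / 2 ^ d * of_nat (f (a - 2 * d)))"
  unfolding matching_sum_def
  by (rule sum.mono_neutral_left) (use assms in \<open>auto simp: matching_count_eq_0\<close>)

lemma matching_sum_add:
  "matching_sum a (\<lambda>i. f i + g i) = matching_sum a f + matching_sum a g"
  by (simp add: matching_sum_def distrib_left sum.distrib)

lemma matching_sum_mult: "matching_sum a (\<lambda>i. k * f i) = of_nat k * matching_sum a f"
  by (simp add: matching_sum_def sum_distrib_left mult_ac)

text \<open>The factor \<open>i\<close> marks an uncovered vertex; by
  \<open>matching_count_absorb\<close> the mark can be placed before the matching is chosen.\<close>

lemma matching_sum_absorb:
  "matching_sum a (\<lambda>i. i * f (i - 1)) = of_nat a * matching_sum (a - 1) f"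
proof (cases a)
  case 0
  then show ?thesis by (simp add: matching_sum_def)
next
  case (Suc b)
  have "of_nat (matching_count (Suc b) d) / 2 ^ d * of_nat ((Suc b - 2 * d) * f (Suc b - 2 * d - 1))
      = of_nat (Suc b) * (of_nat (matching_count b d) / 2 ^ d * (of_nat (f (b - 2 * d)) :: rat))" for d
  proof -
    have "of_nat (Suc b - 2 * d) * of_nat (matching_count (Suc b) d)
        = of_nat (Suc b) * (of_nat (matching_count b d) :: rat)"
      unfolding of_nat_mult[symmetric] matching_count_absorb ..
    moreover have "Suc b - 2 * d - 1 = b - 2 * d" by simp
    ultimately show ?thesis
      by (simp only: of_nat_mult times_divide_eq_left times_divide_eq_right) (simp add: mult_ac)
  qed
  then have "matching_sum (Suc b) (\<lambda>i. i * f (i - 1)) = of_nat (Suc b) * matching_sum b f"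
    unfolding matching_sum_eq[OF order_refl, of "Suc b"]
      matching_sum_eq[OF le_SucI[OF order_refl], of b]
    by (simp only: sum_distrib_left)
  then show ?thesis by (simp add: Suc)
qed

lemma double_choose_two: "2 * (n choose 2) = n * (n - 1)"
  unfolding choose_two by (rule dvd_mult_div_cancel) (cases n; simp)

text \<open>After doubling, the binomial coefficient is \<open>i * (i - 1)\<close>, and two
  applications of \<open>matching_sum_absorb\<close> suffice.\<close>

lemma matching_sum_choose_2:
  "matching_sum a (\<lambda>i. (i choose 2) * f (i - 2)) = of_nat (a choose 2) * matching_sum (a - 2) f"
proof -
  have "2 * matching_sum a (\<lambda>i. (i choose 2) * f (i - 2))
      = matching_sum a (\<lambda>i. 2 * (i choose 2) * f (i - 2))"
    using matching_sum_mult[of a 2 "\<lambda>i. (i choose 2) * f (i - 2)"] by (simp add: mult.assoc)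
  also have "\<dots> = matching_sum a (\<lambda>i. i * ((i - 1) * f (i - 1 - 1)))"
    unfolding double_choose_two by (simp add: mult.assoc numeral_2_eq_2)
  also have "\<dots> = of_nat (a * (a - 1)) * matching_sum (a - 2) f"
    unfolding matching_sum_absorb[of _ "\<lambda>i. i * f (i - 1)"] matching_sum_absorb[of _ f]
    by (simp add: numeral_2_eq_2)
  finally show ?thesis unfolding double_choose_two[symmetric] by simp
qed

text \<open>This is \<open>matching_count_Suc\<close> in weighted form. A fixed uncovered vertex
  raises the argument of \<open>f\<close> by one; a fixed matched vertex has \<open>Suc a\<close>
  partners, and its edge carries weight 1/2.\<close>

lemma matching_sum_Suc_Suc:
  "matching_sum (Suc (Suc a)) f
    = matching_sum (Suc a) (\<lambda>i. f (Suc i)) + of_nat (Suc a) / 2 * matching_sum a f"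
proof -
  define w :: "nat \<Rightarrow> nat \<Rightarrow> nat \<Rightarrow> rat"
    where "w b d i = of_nat (matching_count b d) / 2 ^ d * of_nat (f i)" for b d i
  have "matching_sum (Suc (Suc a)) f = (\<Sum>d\<le>Suc (Suc a). w (Suc (Suc a)) d (Suc (Suc a) - 2 * d))"
    by (simp add: matching_sum_def w_def)
  also have "\<dots> = w (Suc (Suc a)) 0 (Suc (Suc a)) + (\<Sum>d\<le>Suc a. w (Suc (Suc a)) (Suc d) (a - 2 * d))"
    by (subst sum.atMost_Suc_shift) simp
  also have "(\<Sum>d\<le>Suc a. w (Suc (Suc a)) (Suc d) (a - 2 * d))
      = (\<Sum>d\<le>Suc a. w (Suc a) (Suc d) (a - 2 * d)) + (\<Sum>d\<le>Suc a. of_nat (Suc a) / 2 * w a d (a - 2 * d))"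
    by (simp only: sum.distrib[symmetric])
       (rule sum.cong, simp_all add: w_def matching_count_Suc field_simps)
  also have "(\<Sum>d\<le>Suc a. of_nat (Suc a) / 2 * w a d (a - 2 * d)) = of_nat (Suc a) / 2 * matching_sum a f"
    by (simp only: matching_sum_eq[OF le_SucI[OF order_refl], of a] w_def sum_distrib_left)
  also have "w (Suc (Suc a)) 0 (Suc (Suc a)) = w (Suc a) 0 (Suc (Suc a))"
    by (simp add: w_def)
  finally have "matching_sum (Suc (Suc a)) f
      = (w (Suc a) 0 (Suc (Suc a)) + (\<Sum>d\<le>Suc a. w (Suc a) (Suc d) (a - 2 * d)))
        + of_nat (Suc a) / 2 * matching_sum a f"
    by simp
  also have "w (Suc a) 0 (Suc (Suc a)) + (\<Sum>d\<le>Suc a. w (Suc a) (Suc d) (a - 2 * d))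
      = (\<Sum>d\<le>Suc (Suc a). w (Suc a) d (Suc (Suc a) - 2 * d))"
    by (subst (2) sum.atMost_Suc_shift) simp
  \<comment> \<open>The two arguments differ only when the subtraction truncates, and there the
    matching count is 0.\<close>
  also have "\<dots> = (\<Sum>d\<le>Suc (Suc a). w (Suc a) d (Suc (Suc a - 2 * d)))"
  proof (rule sum.cong)
    fix d
    show "w (Suc a) d (Suc (Suc a) - 2 * d) = w (Suc a) d (Suc (Suc a - 2 * d))"
      by (cases "2 * d \<le> Suc a") (simp_all add: Suc_diff_le w_def matching_count_eq_0)
  qed simp
  also have "\<dots> = matching_sum (Suc a) (\<lambda>i. f (Suc i))"
    by (simp only: matching_sum_eq[OF le_SucI[OF order_refl], of "Suc a"] w_def)
  finally show ?thesis .
qed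

section \<open>Comparison with the recurrence for involutions\<close>

lemma invol_rec: "invol (Suc n) = invol n + n * invol (n - 1)"
  by (cases n) auto

text \<open>This is the form taken by the recurrence of \<open>W\<close> when \<open>b = 0\<close>,
  where \<open>matching_sum_Suc_Suc\<close> leads from \<open>a' + 2\<close> back to
  \<open>a' + 1\<close> and \<open>a'\<close>.\<close>

lemma invol_add_4: "invol (n + 4) = 2 * invol (n + 3) + (n + 2) * (n + 1) * invol n"
  by (simp add: numeral_eq_Suc algebra_simps)

text \<open>Induction on \<open>2 * a + b\<close>. For positive \<open>b\<close> the recurrence of
  \<open>graph_count\<close> passes to the sums and becomes \<open>invol_rec\<close>; for
  \<open>b = 0\<close> it becomes \<open>invol_add_4\<close>.\<close>

lemma invol_eq_matching_sum:
  "of_nat (invol (2 * a + b)) = 2 ^ a * matching_sum a (\<lambda>i. graph_count i b)"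
proof (induction "2 * a + b" arbitrary: a b rule: less_induct)
  case less
  have IH: "2 ^ a' * matching_sum a' (\<lambda>i. graph_count i b') = of_nat (invol (2 * a' + b'))"
    if "2 * a' + b' < 2 * a + b" for a' b' using less[OF that] by simp
  show ?case
  proof (cases b)
    case (Suc b')
    let ?n = "2 * a + b'"
    have "matching_sum a (\<lambda>i. graph_count i (Suc b'))
        = matching_sum a (\<lambda>i. graph_count i b' + b' * graph_count i (b' - 1) + i * graph_count (i - 1) (Suc b'))"
      by (intro arg_cong[of _ _ "matching_sum a"] ext graph_count_Suc_right)
    also have "\<dots> = matching_sum a (\<lambda>i. graph_count i b') + of_nat b' * matching_sum a (\<lambda>i. graph_count i (b' - 1))
        + of_nat a * matching_sum (a - 1) (\<lambda>i. graph_count i (Suc b'))"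
      by (simp only: matching_sum_add matching_sum_mult
          matching_sum_absorb[of a "\<lambda>i. graph_count i (Suc b')"])
    finally have "2 ^ a * matching_sum a (\<lambda>i. graph_count i (Suc b'))
        = 2 ^ a * matching_sum a (\<lambda>i. graph_count i b')
        + of_nat b' * (2 ^ a * matching_sum a (\<lambda>i. graph_count i (b' - 1)))
        + 2 ^ a * (of_nat a * matching_sum (a - 1) (\<lambda>i. graph_count i (Suc b')))"
      by (simp add: algebra_simps)
    also have "of_nat b' * (2 ^ a * matching_sum a (\<lambda>i. graph_count i (b' - 1)))
        = of_nat (b' * invol (?n - 1))"
      by (cases b') (simp_all add: IH Suc distrib_right)
    \<comment> \<open>Lowering \<open>a\<close> by one frees a factor 2 of the power, so this term
      and the previous one add up to the coefficient \<open>2 * a + b'\<close>.\<close>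
    also have "2 ^ a * (of_nat a * matching_sum (a - 1) (\<lambda>i. graph_count i (Suc b')))
        = of_nat (2 * a * invol (?n - 1))"
    proof (cases a)
      case (Suc a')
      have "2 ^ a * (of_nat a * matching_sum (a - 1) (\<lambda>i. graph_count i (Suc b')))
          = 2 * of_nat a * (2 ^ a' * matching_sum a' (\<lambda>i. graph_count i (Suc b')))"
        by (simp add: Suc mult_ac)
      also have "2 ^ a' * matching_sum a' (\<lambda>i. graph_count i (Suc b')) = of_nat (invol (?n - 1))"
        by (subst IH) (simp_all add: Suc \<open>b = Suc b'\<close>)
      finally show ?thesis by simp
    qed simp
    also have "2 ^ a * matching_sum a (\<lambda>i. graph_count i b') = of_nat (invol ?n)"
      by (rule IH) (simp add: Suc)
    also have "of_nat (invol ?n) + of_nat (b' * invol (?n - 1)) + of_nat (2 * a * invol (?n - 1))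
        = (of_nat (invol ?n + ?n * invol (?n - 1)) :: rat)"
      by (simp add: algebra_simps)
    also have "\<dots> = of_nat (invol (2 * a + b))"
      unfolding invol_rec[symmetric] Suc by simp
    finally show ?thesis using Suc by simp
  next
    case b: 0
    consider "a = 0" | "a = 1" | a' where "a = Suc (Suc a')"
      by (metis One_nat_def not0_implies_Suc)
    then show ?thesis
    proof cases
      case 1
      then show ?thesis using b by (simp add: matching_sum_def graph_count.simps)
    next
      case 2
      then show ?thesis
        using b by (simp add: matching_sum_def matching_count_eq_0 graph_count.simps numeral_2_eq_2)
    next
      case (3 a')
      have e: "2 * Suc a' + 1 = 2 * a' + 3" by simp
      \<comment> \<open>The first two terms come from leaving a fixed vertex uncovered and deleting
        it from the graph, the third from matching it.\<close>
      have "2 ^ a * matching_sum a (\<lambda>i. graph_count i 0)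
          = 2 * (2 ^ Suc a' * matching_sum (Suc a') (\<lambda>i. graph_count i 1))
          + 4 * (of_nat (Suc a' choose 2) * (2 ^ a' * matching_sum (a' - 1) (\<lambda>i. graph_count i 2)))
          + 2 * of_nat (Suc a') * (2 ^ a' * matching_sum a' (\<lambda>i. graph_count i 0))"
        unfolding 3 matching_sum_Suc_Suc graph_count_Suc_0 matching_sum_add
          matching_sum_choose_2[of _ "\<lambda>i. graph_count i 2"]
        by (simp add: algebra_simps)
      also have "2 ^ Suc a' * matching_sum (Suc a') (\<lambda>i. graph_count i 1) = of_nat (invol (2 * a' + 3))"
        unfolding e[symmetric] by (rule IH) (simp add: 3 b)
      also have "2 ^ a' * matching_sum a' (\<lambda>i. graph_count i 0) = of_nat (invol (2 * a'))"
        using IH[of a' 0] by (simp add: 3)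
      \<comment> \<open>For \<open>a' = 0\<close> both sides vanish; otherwise the spare factor 2 of
        \<open>2 ^ a'\<close> clears the denominator of the binomial coefficient.\<close>
      also have "of_nat (Suc a' choose 2) * (2 ^ a' * matching_sum (a' - 1) (\<lambda>i. graph_count i 2))
          = of_nat (Suc a' * a' * invol (2 * a'))"
      proof (cases a')
        case (Suc a'')
        have "2 * a'' + 2 = 2 * a'" by (simp add: Suc)
        then have "2 ^ a'' * matching_sum a'' (\<lambda>i. graph_count i 2) = of_nat (invol (2 * a'))"
          using IH[of a'' 2] by (simp add: 3)
        moreover have "of_nat (Suc a' choose 2) * 2 = (of_nat (Suc a' * a') :: rat)"
          using arg_cong[OF double_choose_two[of "Suc a'"], of "of_nat :: nat \<Rightarrow> rat"]
          by (simp add: mult.commute)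
        moreover have "2 ^ a' = 2 * (2 :: rat) ^ a''" "a' - 1 = a''" by (simp_all add: Suc)
        ultimately show ?thesis by (simp add: mult.assoc[symmetric] del: of_nat_Suc)
      qed simp
      also have "2 * of_nat (invol (2 * a' + 3)) + 4 * of_nat (Suc a' * a' * invol (2 * a'))
          + 2 * of_nat (Suc a') * of_nat (invol (2 * a'))
          = (of_nat (2 * invol (2 * a' + 3) + (2 * a' + 2) * (2 * a' + 1) * invol (2 * a')) :: rat)"
        by (simp add: algebra_simps)
      also have "\<dots> = of_nat (invol (2 * a' + 4))"
        by (simp only: invol_add_4)
      also have "2 * a' + 4 = 2 * a + b" by (simp add: 3 b)
      finally show ?thesis using b by simp
    qed
  qed
qed

section \<open>Odd products and the final formula\<close>

lemma step_prod_Suc: "step_prod a b (Suc m) = step_prod a b m * (a + of_nat m * b)"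
  by (simp add: step_prod_def)

lemma step_prod_1_2_pos: "(step_prod 1 2 m :: rat) > 0"
  unfolding step_prod_def by (rule prod_pos) (simp add: add_pos_nonneg)

lemma of_nat_step_prod: "of_nat (step_prod a b m) = step_prod (of_nat a) (of_nat b) m"
  by (simp add: step_prod_def)

text \<open>The factorial splits into its odd factors, which form the step product, and its
  \<open>d\<close> even factors, whose product is \<open>2 ^ d * fact d\<close>.\<close>

lemma step_prod_1_2_mult_fact:
  assumes "s < 2"
  shows "step_prod 1 2 (d + s) * 2 ^ d * fact d = (fact (2 * d + s) :: rat)"
proof (induction d)
  case 0
  then show ?case using assms by (auto simp: less_2_cases_iff step_prod_def)
next
  case (Suc d)
  have "step_prod 1 2 (Suc d + s) * 2 ^ Suc d * fact (Suc d)
      = (step_prod 1 2 (d + s) * 2 ^ d * fact d) * ((1 + of_nat (d + s) * 2) * (2 * (of_nat d + 1)) :: rat)"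
    by (simp add: step_prod_Suc algebra_simps)
  also have "\<dots> = fact (2 * d + s) * ((of_nat (2 * d + s) + 1) * (of_nat (2 * d + s) + 2))"
    unfolding Suc.IH using assms by (auto simp: less_2_cases_iff algebra_simps)
  also have "\<dots> = fact (2 * Suc d + s)"
    by (simp add: algebra_simps)
  finally show ?case .
qed

text \<open>Here \<open>2 * i + s\<close> vertices stay uncovered. Once the factorials are split
  into odd and even parts, \<open>step_prod 1 2 (k - i)\<close> and all powers of 2 cancel, and the
  remaining factorials form the binomial coefficient.\<close>

lemma matching_count_step_prod:
  assumes "s < 2" "i \<le> k"
  shows "(of_nat (matching_count (2 * k + s) (k - i)) :: rat)
    = of_nat (k choose i) * (step_prod 1 2 (k + s) / step_prod 1 2 (i + s))"
proof -
  define d where "d = k - i"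
  have k: "k = i + d" using assms by (simp add: d_def)
  have pos: "step_prod 1 2 m \<noteq> (0 :: rat)" for m using step_prod_1_2_pos[of m] by simp
  have "2 * k + s - 2 * d = 2 * i + s" "2 * d \<le> 2 * k + s" using k by simp_all
  then have "of_nat (matching_count (2 * k + s) d)
      = fact (2 * k + s) / (fact (2 * d) * fact (2 * i + s)) * (step_prod 1 2 d :: rat)"
    by (simp add: matching_count_def of_nat_step_prod binomial_fact)
  also have "\<dots> = (step_prod 1 2 (k + s) * 2 ^ k * fact k)
      / ((step_prod 1 2 d * 2 ^ d * fact d) * (step_prod 1 2 (i + s) * 2 ^ i * fact i)) * step_prod 1 2 d"
    using step_prod_1_2_mult_fact[of 0 d] step_prod_1_2_mult_fact[OF assms(1)] by simp
  also have "\<dots> = fact k / (fact i * fact d) * (step_prod 1 2 (k + s) / step_prod 1 2 (i + s))"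
    using pos by (simp add: k power_add field_simps)
  also have "fact k / (fact i * fact d) = (of_nat (k choose i) :: rat)"
    using assms by (simp add: binomial_fact d_def)
  finally show ?thesis unfolding d_def .
qed

theorem theorem3p2:
  fixes n k r :: nat
  assumes "n = 4 * k + r" and "r < 4"
  shows "rat_of_nat (num_involutions n) =
    2 ^ (k + r div 2) *
      (\<Sum>i = 0..k. 2 ^ i * rat_of_nat (k choose i)
         * (step_prod 1 2 (k + r div 2) / step_prod 1 2 (i + r div 2))
         * rat_of_nat (num_graphs (4 * i + r)))"
proof -
  \<comment> \<open>\<open>u\<close> is the number of merged pairs, and \<open>r mod 2\<close> tells
    whether a single point remains.\<close>
  define s u where "s = r div 2" and "u = 2 * k + s"
  have s: "s < 2" using assms by (simp add: s_def)
  define h :: "nat \<Rightarrow> rat" where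
    "h d = of_nat (matching_count u d) / 2 ^ d * of_nat (graph_count (u - 2 * d) (r mod 2))" for d
  have "n = 2 * u + r mod 2" unfolding assms(1) u_def s_def by simp
  then have "of_nat (num_involutions n) = 2 ^ u * (\<Sum>d\<le>u. h d)"
    unfolding num_involutions_eq by (simp only: invol_eq_matching_sum matching_sum_def h_def)
  \<comment> \<open>Since \<open>s < 2\<close>, more than \<open>k\<close> disjoint edges do not fit
    on \<open>u\<close> vertices.\<close>
  also have "(\<Sum>d\<le>u. h d) = (\<Sum>d\<le>k. h d)"
    by (rule sum.mono_neutral_right) (use s in \<open>auto simp: u_def h_def matching_count_eq_0\<close>)
  also have "\<dots> = (\<Sum>i=0..k. h (k - i))"
    using sum.atLeastAtMost_rev[of h 0 k] by (simp add: atMost_atLeast0)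
  \<comment> \<open>A factor \<open>2 ^ k\<close> moves inside the sum, where the weight
    \<open>1 / 2 ^ (k - i)\<close> reduces it to \<open>2 ^ i\<close>.\<close>
  also have "2 ^ u * \<dots> = 2 ^ (k + s) * (\<Sum>i=0..k. 2 ^ k * h (k - i))"
    by (simp only: sum_distrib_left[symmetric]) (simp add: u_def power_add mult_2)
  also have "(\<Sum>i=0..k. 2 ^ k * h (k - i)) = (\<Sum>i = 0..k. 2 ^ i * rat_of_nat (k choose i)
         * (step_prod 1 2 (k + s) / step_prod 1 2 (i + s)) * rat_of_nat (num_graphs (4 * i + r)))"
  proof (rule sum.cong)
    fix i assume "i \<in> {0..k}"
    then have i: "i \<le> k" by simp
    then have "u - 2 * (k - i) = (4 * i + r) div 2" by (simp add: u_def s_def)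
    moreover have mod2: "(4 * i + r) mod 2 = r mod 2" by presburger
    ultimately have "num_graphs (4 * i + r) = graph_count (u - 2 * (k - i)) (r mod 2)"
      by (simp add: num_graphs_eq mod2)
    moreover have "(2 :: rat) ^ k = 2 ^ i * 2 ^ (k - i)"
      using i by (simp flip: power_add)
    moreover note matching_count_step_prod[OF s i]
    ultimately show "2 ^ k * h (k - i) = 2 ^ i * rat_of_nat (k choose i)
         * (step_prod 1 2 (k + s) / step_prod 1 2 (i + s)) * rat_of_nat (num_graphs (4 * i + r))"
      by (simp add: h_def flip: u_def)
  qed simp
  finally show ?thesis unfolding s_def .
qed

end
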